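(* Let $n\ge 1$ and let $\mu$ be a valuation on $\mathcal{C}^n$ which is rigid motion invariant, decreasing, m-continuous and simple. Then there exists a decreasing function $f:\mathbb{R}\to\mathbb{R}$, right-continuous and verifying $$\int_0^\infty f(t)\,t^{n-1}\,dt<\infty,$$ such that $$\mu(u)=\int_{\mathrm{dom}(u)} f(u(x))\,dx\qquad\text{for every }u\in\mathcal{C}^n .$$
   Context: $\mathcal{C}^n$ is the set of all convex, lower semi-continuous functions $u:\mathbb{R}^n\to\mathbb{R}\cup\{\infty\}$ with $\lim_{|x|\to\infty}u(x)=\infty$; it contains the function $\boldsymbol{\infty}$ identically equal to $\infty$. $\mathrm{dom}(u)=\{x: u(x)<\infty\}$. $u\vee v$ and $u\wedge v$ denote pointwise maximum and minimum. A valuation on $\mathcal{C}^n$ is a map $\mu:\mathcal{C}^n\to\mathbb{R}$ with $\mu(\boldsymbol{\infty})=0$ and $\mu(u\vee v)+\mu(u\wedge v)=\mu(u)+\mu(v)$ for all $u,v\in\mathcal{C}^n$ such that $u\wedge v\in\mathcal{C}^n$. It is: - rigid motion invariant if $\mu(u\circ T)=\mu(u)$ for all $u\in\mathcal{C}^n$ and all rigid motions $T$ (maps $T(x)=Rx+x_0$ with $R\in\mathbf{O}(n)$, $x_0\in\mathbb{R}^n$); - decreasing if $\mu(u)\le\mu(v)$ whenever $u\ge v$ pointwise in $\mathbb{R}^n$; - m-continuous if $\lim_{i\to\infty}\mu(u_i)=\mu(u)$ whenever $u,u_i\in\mathcal{C}^n$ satisfy $u_i\ge u_{i+1}\ge u$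 in $\mathbb{R}^n$ for every $i$ and $u_i(x)\to u(x)$ for every $x$ in the relative interior of $\mathrm{dom}(u)$; - simple if $\mu(u)=0$ for every $u\in\mathcal{C}^n$ such that $\mathrm{dom}(u)$ has empty interior (i.e. $\dim(\mathrm{dom}(u))<n$). "Decreasing" for functions on $\mathbb{R}$ means non-increasing; $dx$ is Lebesgue measure in $\mathbb{R}^n$. *)

theory Defs
  imports "HOL-Analysis.Analysis"
begin

definition eff_dom :: "('a \<Rightarrow> ereal) \<Rightarrow> 'a set" where
  "eff_dom u = {x. u x < \<infinity>}"

(* Values lie in the reals extended by +\<infinity> only, so with positive weights the right-hand side
   of the convexity inequality is never an undetermined form. *)
definition convex_fun :: "('a::real_vector \<Rightarrow> ereal) \<Rightarrow> bool" where
  "convex_fun u \<longleftrightarrow> (\<forall>x. u x \<noteq> -\<infinity>) \<and>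
     (\<forall>x y t. 0 < t \<and> t < 1 \<longrightarrow>
        u ((1 - t) *\<^sub>R x + t *\<^sub>R y) \<le> ereal (1 - t) * u x + ereal t * u y)"

definition lower_semicont :: "('a::topological_space \<Rightarrow> ereal) \<Rightarrow> bool" where
  "lower_semicont u \<longleftrightarrow> (\<forall>x. u x \<le> Liminf (at x) u)"

definition conv_coercive :: "(real ^ 'n \<Rightarrow> ereal) set" where
  "conv_coercive = {u. convex_fun u \<and> lower_semicont u \<and> (u \<longlongrightarrow> \<infinity>) at_infinity}"

(* A valuation is only constrained on the function class; its values elsewhere are junk. *)
definition valuation :: "((real ^ 'n \<Rightarrow> ereal) \<Rightarrow> real) \<Rightarrow> bool" where
  "valuation \<mu> \<longleftrightarrow> \<mu> (\<lambda>x. \<infinity>) = 0 \<and>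
     (\<forall>u\<in>conv_coercive. \<forall>v\<in>conv_coercive. (\<lambda>x. min (u x) (v x)) \<in> conv_coercive \<longrightarrow>
        \<mu> (\<lambda>x. max (u x) (v x)) + \<mu> (\<lambda>x. min (u x) (v x)) = \<mu> u + \<mu> v)"

definition rigid_motion_invariant :: "((real ^ 'n \<Rightarrow> ereal) \<Rightarrow> real) \<Rightarrow> bool" where
  "rigid_motion_invariant \<mu> \<longleftrightarrow>
     (\<forall>u\<in>conv_coercive. \<forall>R x0. orthogonal_matrix R \<longrightarrow> \<mu> (u \<circ> (\<lambda>x. R *v x + x0)) = \<mu> u)"

definition decreasing_val :: "((real ^ 'n \<Rightarrow> ereal) \<Rightarrow> real) \<Rightarrow> bool" where
  "decreasing_val \<mu> \<longleftrightarrow>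
     (\<forall>u\<in>conv_coercive. \<forall>v\<in>conv_coercive. (\<forall>x. u x \<ge> v x) \<longrightarrow> \<mu> u \<le> \<mu> v)"

definition m_continuous :: "((real ^ 'n \<Rightarrow> ereal) \<Rightarrow> real) \<Rightarrow> bool" where
  "m_continuous \<mu> \<longleftrightarrow>
     (\<forall>u\<in>conv_coercive. \<forall>U. (\<forall>i::nat. U i \<in> conv_coercive) \<and>
        (\<forall>i x. U i x \<ge> U (Suc i) x \<and> U (Suc i) x \<ge> u x) \<and>
        (\<forall>x\<in>rel_interior (eff_dom u). (\<lambda>i. U i x) \<longlonglongrightarrow> u x)
        \<longrightarrow> (\<lambda>i. \<mu> (U i)) \<longlonglongrightarrow> \<mu> u)"

definition simple_val :: "((real ^ 'n \<Rightarrow> ereal) \<Rightarrow> real) \<Rightarrow> bool" where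
  "simple_val \<mu> \<longleftrightarrow> (\<forall>u\<in>conv_coercive. interior (eff_dom u) = {} \<longrightarrow> \<mu> u = 0)"

end

(* Write u + I_S for the function equal to u on S and to infinity off S. Cutting along a hyperplane
   and simplicity make K |-> mu(u + I_K) a finitely additive function of boxes K. For constant u = t
   it is also translation invariant and nonnegative, hence equal to f(t) vol(K). On a small box around
   an interior point x of dom(u) continuity of u and monotonicity of mu squeeze mu(u + I_K) between
   values of f near u(x) times vol(K), so mu(u + I_B) is the (gauge) integral of f o u over B; the
   boundary of dom(u) is negligible because dom(u) is convex. Since f may jump on the left, the upper
   bound is first obtained for u + d with d > 0, and d -> 0 by m-continuity. Exhausting space by boxes
   gives the formula, and u = |x| in polar coordinates gives the moment condition. *)
theory Submission
  imports Defs
begin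

subsection \<open>Convex functions with values in the extended reals\<close>

text \<open>This is \<open>u + I_S\<close> with \<open>I_S\<close> the indicator function of convex
  analysis; the definition by cases avoids sums in \<open>ereal\<close>.\<close>

definition restr :: "('a \<Rightarrow> ereal) \<Rightarrow> 'a set \<Rightarrow> 'a \<Rightarrow> ereal" where
  "restr u S = (\<lambda>x. if x \<in> S then u x else \<infinity>)"

lemma restr_inside [simp]: "x \<in> S \<Longrightarrow> restr u S x = u x"
  by (simp add: restr_def)

lemma restr_outside [simp]: "x \<notin> S \<Longrightarrow> restr u S x = \<infinity>"
  by (simp add: restr_def)

lemma le_restr: "u x \<le> restr u S x"
  by (simp add: restr_def)

lemma eff_dom_restr: "eff_dom (restr u S) = S \<inter> eff_dom u"
  by (auto simp: eff_dom_def restr_def)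

text \<open>Punctured neighbourhoods may be replaced by full ones, because the inequality at
  \<open>x\<close> itself is the assumption \<open>y < u x\<close>.\<close>

lemma lower_semicont_iff:
  "lower_semicont u \<longleftrightarrow> (\<forall>x y. y < u x \<longrightarrow> (\<forall>\<^sub>F z in nhds x. y < u z))"
  unfolding lower_semicont_def le_Liminf_iff by (auto simp: eventually_nhds_conv_at)

lemma convex_fun_restr:
  assumes "convex_fun u" "convex S"
  shows "convex_fun (restr u S)"
  unfolding convex_fun_def
proof (intro conjI allI impI)
  show "restr u S x \<noteq> -\<infinity>" for x
    using assms(1) by (auto simp: convex_fun_def restr_def)
  fix x y and t :: real
  assume t: "0 < t \<and> t < 1"
  show "restr u S ((1 - t) *\<^sub>R x + t *\<^sub>R y) \<le> ereal (1 - t) * restr u S x + ereal t * restr u S y"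
  proof (cases "x \<in> S \<and> y \<in> S")
    case True
    then have "(1 - t) *\<^sub>R x + t *\<^sub>R y \<in> S"
      using assms(2) t by (simp add: convex_alt)
    with True t assms(1) show ?thesis by (simp add: convex_fun_def)
  next
    case False
    \<comment> \<open>One endpoint lies off \<open>S\<close>; its value stays infinite under a
      positive weight and absorbs the other summand.\<close>
    then have "ereal (1 - t) * restr u S x + ereal t * restr u S y = \<infinity>"
      using t by (auto simp: restr_def)
    then show ?thesis by (metis ereal_less_eq(1))
  qed
qed

text \<open>At points of \<open>S\<close> restricting only raises nearby values; the complement of
  \<open>S\<close> is open and the function is constantly infinite there.\<close>

lemma lower_semicont_restr:
  assumes "lower_semicont u" "closed S"
  shows "lower_semicont (restr u S)"
  unfolding lower_semicont_iff
proof (intro allI impI)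
  fix x y assume y: "y < restr u S x"
  show "\<forall>\<^sub>F z in nhds x. y < restr u S z"
  proof (cases "x \<in> S")
    case True
    then have "\<forall>\<^sub>F z in nhds x. y < u z"
      using y assms(1) by (simp add: lower_semicont_iff)
    then show ?thesis
      by eventually_elim (meson le_restr less_le_trans)
  next
    case False
    then have "\<forall>\<^sub>F z in nhds x. z \<in> - S"
      using assms(2) by (intro eventually_nhds_in_open) auto
    then show ?thesis
      by eventually_elim (use y False in auto)
  qed
qed

lemma convex_fun_ereal:
  assumes "convex_on UNIV g"
  shows "convex_fun (\<lambda>x. ereal (g x))"
  using assms by (auto simp: convex_fun_def convex_on_def)

lemma convex_fun_add_const:
  assumes "convex_fun u"
  shows "convex_fun (\<lambda>x. u x + ereal c)"
  unfolding convex_fun_def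
proof (intro conjI allI impI)
  show "u x + ereal c \<noteq> -\<infinity>" for x
    using assms by (simp add: convex_fun_def)
  fix x y and t :: real
  assume t: "0 < t \<and> t < 1"
  have "u ((1 - t) *\<^sub>R x + t *\<^sub>R y) + ereal c \<le> (ereal (1 - t) * u x + ereal t * u y) + ereal c"
    using assms t by (intro add_right_mono) (simp add: convex_fun_def)
  also have "\<dots> = ereal (1 - t) * (u x + ereal c) + ereal t * (u y + ereal c)"
    using t by (cases "u x"; cases "u y") (auto simp: algebra_simps)
  finally show "u ((1 - t) *\<^sub>R x + t *\<^sub>R y) + ereal c
    \<le> ereal (1 - t) * (u x + ereal c) + ereal t * (u y + ereal c)" .
qed

lemma lower_semicont_ereal:
  fixes g :: "'a::t2_space \<Rightarrow> real"
  assumes "continuous_on UNIV g"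
  shows "lower_semicont (\<lambda>x. ereal (g x))"
  unfolding lower_semicont_iff
proof (intro allI impI)
  fix x y assume y: "y < ereal (g x)"
  have "isCont g x"
    using assms by (simp add: continuous_on_eq_continuous_at)
  then have "((\<lambda>x. ereal (g x)) \<longlongrightarrow> ereal (g x)) (nhds x)"
    by (simp add: isCont_def tendsto_at_iff_tendsto_nhds)
  from order_tendstoD(1)[OF this y] show "\<forall>\<^sub>F z in nhds x. y < ereal (g z)" .
qed

lemma lower_semicont_add_const:
  assumes "lower_semicont u"
  shows "lower_semicont (\<lambda>x. u x + ereal c)"
  unfolding lower_semicont_iff
proof (intro allI impI)
  have iff: "y < z + ereal c \<longleftrightarrow> y - ereal c < z" for y z :: ereal
    by (cases y; cases z) auto
  fix x y assume "y < u x + ereal c"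
  then show "\<forall>\<^sub>F z in nhds x. y < u z + ereal c"
    using assms unfolding iff lower_semicont_iff by blast
qed

section \<open>Membership in the class of coercive convex functions\<close>

lemma conv_coerciveD:
  assumes "u \<in> conv_coercive"
  shows "convex_fun u" "lower_semicont u"
  using assms by (auto simp: conv_coercive_def)

lemma conv_coercive_restr:
  assumes "u \<in> conv_coercive" "convex S" "closed S"
  shows "restr u S \<in> conv_coercive"
proof -
  have "(restr u S \<longlongrightarrow> \<infinity>) at_infinity"
    using assms(1) unfolding conv_coercive_def tendsto_PInfty
    by (auto elim!: eventually_mono intro: less_le_trans[OF _ le_restr])
  then show ?thesis
    using assms by (simp add: conv_coercive_def convex_fun_restr lower_semicont_restr)
qed

text \<open>Outside a bounded set the restriction is infinite, so compactness supplies coercivity.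
  This admits constants cut down to boxes.\<close>

lemma conv_coercive_restr_compact:
  assumes "convex_fun u" "lower_semicont u" "convex K" "compact K"
  shows "restr u K \<in> conv_coercive"
proof -
  obtain b where "\<And>x. x \<in> K \<Longrightarrow> norm x \<le> b"
    using compact_imp_bounded[OF assms(4)] by (auto simp: bounded_iff)
  then have "\<forall>\<^sub>F x in at_infinity. x \<notin> K"
    unfolding eventually_at_infinity by (intro exI[of _ "b + 1"]) force
  then have "(restr u K \<longlongrightarrow> \<infinity>) at_infinity"
    by (intro tendsto_eventually) (auto elim!: eventually_mono)
  then show ?thesis
    using assms by (simp add: conv_coercive_def convex_fun_restr lower_semicont_restr compact_imp_closed)
qed

lemma infinity_conv_coercive: "(\<lambda>x. \<infinity>) \<in> conv_coercive"
  by (simp add: conv_coercive_def convex_fun_def lower_semicont_iff)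

text \<open>The test function whose integral formula yields the moment condition.\<close>

lemma norm_conv_coercive: "(\<lambda>x::real^'n. ereal (norm x)) \<in> conv_coercive"
proof -
  have "((\<lambda>x::real^'n. ereal (norm x)) \<longlongrightarrow> \<infinity>) at_infinity"
    unfolding tendsto_PInfty eventually_at_infinity
  proof
    show "\<exists>b. \<forall>x::real^'n. b \<le> norm x \<longrightarrow> ereal r < ereal (norm x)" for r
      by (rule exI[of _ "r + 1"]) auto
  qed
  moreover have "convex_on UNIV (norm :: real^'n \<Rightarrow> real)"
    using convex_on_dist[of UNIV "0::real^'n"] by simp
  ultimately show ?thesis
    unfolding conv_coercive_def
    by (simp add: convex_fun_ereal lower_semicont_ereal continuous_on_norm_id)
qed

section \<open>Effective domains and continuity in their interior\<close>

lemma convex_eff_dom: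
  assumes "convex_fun u"
  shows "convex (eff_dom u)"
  unfolding convex_alt
proof (intro ballI allI impI)
  fix x y and t :: real
  assume xy: "x \<in> eff_dom u" "y \<in> eff_dom u" and t: "0 \<le> t \<and> t \<le> 1"
  show "(1 - t) *\<^sub>R x + t *\<^sub>R y \<in> eff_dom u"
  proof (cases "t = 0 \<or> t = 1")
    case True
    with xy show ?thesis by auto
  next
    case False
    then have "u ((1 - t) *\<^sub>R x + t *\<^sub>R y) \<le> ereal (1 - t) * u x + ereal t * u y"
      using assms t by (simp add: convex_fun_def)
    also have "\<dots> < \<infinity>"
      using xy assms by (cases "u x"; cases "u y") (auto simp: eff_dom_def convex_fun_def)
    finally show ?thesis by (simp add: eff_dom_def)
  qed
qed

lemma ereal_real_eff_dom:
  assumes "convex_fun u" "x \<in> eff_dom u"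
  shows "ereal (real_of_ereal (u x)) = u x"
  using assms by (cases "u x") (auto simp: convex_fun_def eff_dom_def)

text \<open>On the interior of the domain, an open convex set, \<open>u\<close> is finite, so the
  continuity theorem for real convex functions applies.\<close>

lemma continuous_on_interior_eff_dom:
  fixes u :: "'a::euclidean_space \<Rightarrow> ereal"
  assumes "convex_fun u"
  shows "continuous_on (interior (eff_dom u)) (\<lambda>x. real_of_ereal (u x))"
proof (rule convex_on_continuous)
  have ci: "convex (interior (eff_dom u))"
    by (simp add: assms convex_eff_dom convex_interior)
  show "convex_on (interior (eff_dom u)) (\<lambda>x. real_of_ereal (u x))"
  proof (rule convex_onI[OF _ ci])
    fix t :: real and x y
    assume t: "0 < t" "t < 1" and xy: "x \<in> interior (eff_dom u)" "y \<in> interior (eff_dom u)"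
    let ?z = "(1 - t) *\<^sub>R x + t *\<^sub>R y"
    have "?z \<in> interior (eff_dom u)"
      using ci t xy by (simp add: convex_alt)
    then have eqs: "u x = ereal (real_of_ereal (u x))" "u y = ereal (real_of_ereal (u y))"
      "u ?z = ereal (real_of_ereal (u ?z))"
      using xy interior_subset ereal_real_eff_dom[OF assms] by (metis subsetD)+
    have "u ?z \<le> ereal (1 - t) * u x + ereal t * u y"
      using assms t by (simp add: convex_fun_def)
    then show "real_of_ereal (u ?z) \<le> (1 - t) * real_of_ereal (u x) + t * real_of_ereal (u y)"
      by (subst (asm) eqs(1), subst (asm) eqs(2), subst (asm) eqs(3)) simp
  qed
qed simp

section \<open>Measurability and lower bounds from lower semicontinuity\<close>

lemma lower_semicont_open_superlevel:
  assumes "lower_semicont u"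
  shows "open {x. y < u x}"
proof (subst open_subopen, safe)
  fix x assume "y < u x"
  then obtain T where "open T" "x \<in> T" "\<forall>z\<in>T. y < u z"
    using assms unfolding lower_semicont_iff eventually_nhds by blast
  then show "\<exists>T. open T \<and> x \<in> T \<and> T \<subseteq> {x. y < u x}" by blast
qed

lemma lower_semicont_borel_measurable:
  fixes u :: "'a::topological_space \<Rightarrow> ereal"
  assumes "lower_semicont u"
  shows "u \<in> borel_measurable borel"
proof (rule borel_measurableI_greater)
  show "{x \<in> space borel. y < u x} \<in> sets borel" for y
    using lower_semicont_open_superlevel[OF assms] by simp
qed

lemma eff_dom_borel:
  fixes u :: "'a::topological_space \<Rightarrow> ereal"
  assumes "lower_semicont u"
  shows "eff_dom u \<in> sets borel"
  using measurable_sets[OF lower_semicont_borel_measurable[OF assms], of "{..<\<infinity>}"]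
  by (simp add: eff_dom_def vimage_def)

text \<open>The open sets where \<open>u\<close> exceeds \<open>-n\<close> cover \<open>K\<close>,
  and a finite subcover gives the bound.\<close>

lemma lower_semicont_bounded_below:
  assumes "lower_semicont u" "\<And>x. u x \<noteq> -\<infinity>" "compact K"
  obtains c :: real where "\<And>x. x \<in> K \<Longrightarrow> ereal c \<le> u x"
proof -
  have "K \<subseteq> (\<Union>n::nat. {x. ereal (- real n) < u x})"
  proof
    fix x
    obtain r where "ereal r < u x"
      using assms(2)[of x] lt_ex[of "real_of_ereal (u x)"] by (cases "u x") (auto intro: that[of 0])
    moreover obtain n :: nat where "- real n \<le> r"
      by (metis minus_le_iff real_arch_simple)
    ultimately have "ereal (- real n) < u x"
      using le_less_trans[of "ereal (- real n)" "ereal r" "u x"] by simp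
    then show "x \<in> (\<Union>n::nat. {x. ereal (- real n) < u x})"
      by blast
  qed
  with lower_semicont_open_superlevel[OF assms(1)]
  obtain F :: "nat set" where F: "finite F" "K \<subseteq> (\<Union>n\<in>F. {x. ereal (- real n) < u x})"
    by (rule compactE_image[OF assms(3)])
  \<comment> \<open>The witness is \<open>- Max F\<close>. For empty \<open>F\<close> the set
    \<open>K\<close> is empty too, so \<open>Max F\<close> is only evaluated when some
    \<open>n\<close> in \<open>F\<close> is at hand.\<close>
  show thesis
  proof
    fix x assume "x \<in> K"
    then obtain n where n: "n \<in> F" "ereal (- real n) < u x"
      using F by auto
    have "ereal (- real (Max F)) \<le> ereal (- real n)"
      using n(1) F(1) by simp
    with n(2) show "ereal (- real (Max F)) \<le> u x"
      by order
  qed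
qed

subsection \<open>Additive functions of boxes\<close>

text \<open>Lets the upper estimate \<open>operative_le_integral\<close> serve for lower estimates
  as well.\<close>

lemma operative_uminus:
  fixes G :: "'a::euclidean_space set \<Rightarrow> real"
  assumes "operative (+) 0 G"
  shows "operative (+) 0 (\<lambda>K. - G K)"
proof -
  interpret operative "(+)" 0 G by fact
  show ?thesis
  proof unfold_locales
    show "- G (cbox a b) = 0" if "box a b = {}" for a b
      using box_empty_imp[OF that] by simp
    show "- G (cbox a b) = - G (cbox a b \<inter> {x. x \<bullet> k \<le> c}) + - G (cbox a b \<inter> {x. x \<bullet> k \<ge> c})"
      if "k \<in> Basis" for a b c k
      using Basis_imp[OF that, of a b c] by simp
  qed
qed

text \<open>Take a tagged division fine for both \<open>\<gamma>\<close> and the gauge belonging to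
  \<open>h\<close>. Additivity writes \<open>G\<close> of the box as a sum over the pieces, the
  local estimate bounds it by a Riemann sum of \<open>h\<close>, and that sum is within
  \<open>e\<close> of \<open>I\<close>.\<close>

lemma operative_le_integral:
  fixes G :: "'a::euclidean_space set \<Rightarrow> real"
  assumes "operative (+) 0 G" and int: "(h has_integral I) (cbox a b)" and "gauge \<gamma>"
    and le: "\<And>x c d. x \<in> cbox c d \<Longrightarrow> cbox c d \<subseteq> cbox a b \<Longrightarrow> cbox c d \<subseteq> \<gamma> x
      \<Longrightarrow> G (cbox c d) \<le> measure lborel (cbox c d) * h x"
  shows "G (cbox a b) \<le> I"
proof (rule field_le_epsilon)
  interpret operative "(+)" 0 G by fact
  fix e :: real assume "0 < e"
  obtain \<gamma>' where "gauge \<gamma>'" and approx: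
    "\<And>p. p tagged_division_of cbox a b \<Longrightarrow> \<gamma>' fine p
      \<Longrightarrow> norm ((\<Sum>(x, K)\<in>p. measure lborel K *\<^sub>R h x) - I) < e"
    using int \<open>0 < e\<close> unfolding has_integral by meson
  obtain p where p: "p tagged_division_of cbox a b" "(\<lambda>x. \<gamma> x \<inter> \<gamma>' x) fine p"
    using fine_division_exists gauge_Int[OF \<open>gauge \<gamma>\<close> \<open>gauge \<gamma>'\<close>] by blast
  then have fine: "\<gamma> fine p" "\<gamma>' fine p"
    by (auto simp: fine_Int)
  have "G (cbox a b) = (\<Sum>(x, K)\<in>p. G K)"
    unfolding sum_def by (rule tagged_division[OF p(1), symmetric])
  also have "\<dots> \<le> (\<Sum>(x, K)\<in>p. measure lborel K * h x)"
  proof (rule sum_mono, safe)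
    fix x K assume xK: "(x, K) \<in> p"
    then obtain c d where "K = cbox c d"
      using tagged_division_ofD(4)[OF p(1)] by blast
    then show "G K \<le> measure lborel K * h x"
      using le[of x c d] tagged_division_ofD(2,3)[OF p(1) xK] fine(1) xK by (auto dest: fineD)
  qed
  also have "\<dots> \<le> I + e"
    using approx[OF p(1) fine(2)] by simp
  finally show "G (cbox a b) \<le> I + e" .
qed

text \<open>Cauchy's functional equation on the half-line: nonnegativity makes an additive function
  monotone, and comparison with integers bounds \<open>n\<close> times the deviation from linearity
  by a constant, for every \<open>n\<close>.\<close>

lemma additive_nonneg_imp_linear:
  fixes \<phi> :: "real \<Rightarrow> real"
  assumes add: "\<And>r s. 0 \<le> r \<Longrightarrow> 0 \<le> s \<Longrightarrow> \<phi> (r + s) = \<phi> r + \<phi> s"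
    and nonneg: "\<And>r. 0 \<le> r \<Longrightarrow> 0 \<le> \<phi> r"
    and "0 \<le> r"
  shows "\<phi> r = r * \<phi> 1"
proof -
  have mult: "\<phi> (real n * s) = real n * \<phi> s" if "0 \<le> s" for n s
  proof (induction n)
    case 0
    show ?case using add[of 0 0] by simp
  next
    case (Suc n)
    have "\<phi> (real (Suc n) * s) = \<phi> (real n * s + s)"
      by (simp add: algebra_simps)
    also have "\<dots> = real (Suc n) * \<phi> s"
      using Suc that by (simp add: add algebra_simps)
    finally show ?case .
  qed
  have mono: "\<phi> s \<le> \<phi> t" if "0 \<le> s" "s \<le> t" for s t
    using add[of s "t - s"] nonneg[of "t - s"] that by simp
  have bound: "real n * \<bar>\<phi> r - r * \<phi> 1\<bar> \<le> \<phi> 1" for n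
  proof -
    \<comment> \<open>With \<open>m\<close> the integer part of \<open>n * r\<close>, monotonicity
      traps \<open>n * \<phi> r\<close> between \<open>m * \<phi> 1\<close> and
      \<open>(m + 1) * \<phi> 1\<close>.\<close>
    define m where "m = nat \<lfloor>real n * r\<rfloor>"
    have m: "real m \<le> real n * r" "real n * r \<le> real (Suc m)"
      using assms(3) by (simp_all add: m_def) linarith
    have "real m * \<phi> 1 \<le> real n * \<phi> r" "real n * \<phi> r \<le> real (Suc m) * \<phi> 1"
      using mono[OF _ m(1)] mono[OF _ m(2)] mult[of 1 m] mult[of 1 "Suc m"] mult[of r n] assms(3)
      by (simp_all add: algebra_simps)
    moreover have "(real n * r - 1) * \<phi> 1 \<le> real m * \<phi> 1" "real (Suc m) * \<phi> 1 \<le> (real n * r + 1) * \<phi> 1"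
      using m nonneg[of 1] by (intro mult_right_mono; simp)+
    ultimately have "\<bar>real n * (\<phi> r - r * \<phi> 1)\<bar> \<le> \<phi> 1"
      by (simp add: algebra_simps abs_le_iff)
    then show ?thesis by (simp add: abs_mult)
  qed
  show ?thesis
  proof (rule ccontr)
    assume "\<phi> r \<noteq> r * \<phi> 1"
    then obtain n :: nat where "\<phi> 1 < real n * \<bar>\<phi> r - r * \<phi> 1\<bar>"
      using ex_less_of_nat_mult[of "\<bar>\<phi> r - r * \<phi> 1\<bar>"] by auto
    with bound[of n] show False by simp
  qed
qed

text \<open>With all sides but one fixed, cutting and translating make \<open>G\<close> additive in
  the remaining side length, hence linear in it. Treating the sides one after another reduces any
  box to the unit cube.\<close>

lemma operative_translation_invariant:
  fixes G :: "'a::euclidean_space set \<Rightarrow> real"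
  assumes "operative (+) 0 G" and nonneg: "\<And>a b. 0 \<le> G (cbox a b)"
    and trans: "\<And>a b v. G (cbox (a + v) (b + v)) = G (cbox a b)"
  shows "G (cbox a b) = measure lborel (cbox a b) * G (cbox 0 One)"
proof -
  interpret operative "(+)" 0 G by fact
  \<comment> \<open>Boxes at the origin are indexed by their side lengths \<open>s\<close>, so that
    \<open>s(k := r)\<close> changes a single side.\<close>
  define V :: "('a \<Rightarrow> real) \<Rightarrow> 'a" where "V s = (\<Sum>i\<in>Basis. s i *\<^sub>R i)" for s
  define F where "F s = G (cbox 0 (V s))" for s
  have V [simp]: "V s \<bullet> i = s i" if "i \<in> Basis" for s i
    using that by (simp add: V_def)
  have split: "F (s(k := r + r')) = F (s(k := r)) + F (s(k := r'))"
    if k: "k \<in> Basis" and r: "0 \<le> r" "0 \<le> r'" for s k r r'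
  proof -
    let ?V = "V (s(k := r + r'))"
    have "(\<Sum>i\<in>Basis. (if i = k then min (?V \<bullet> k) r else ?V \<bullet> i) *\<^sub>R i) = V (s(k := r))"
      unfolding V_def[of "s(k := r)"] using k r by (intro sum.cong) auto
    then have lower: "cbox 0 ?V \<inter> {x. x \<bullet> k \<le> r} = cbox 0 (V (s(k := r)))"
      by (simp only: interval_split[OF k])
    \<comment> \<open>The upper piece of the cut is a translate, by \<open>r\<close> in direction
      \<open>k\<close>, of the box whose side in that direction is \<open>r'\<close>.\<close>
    have "(\<Sum>i\<in>Basis. (if i = k then max (0 \<bullet> k) r else 0 \<bullet> i) *\<^sub>R i) = 0 + r *\<^sub>R k"
      by (rule euclidean_eqI) (use k r in \<open>simp add: inner_Basis\<close>)
    moreover have "?V = V (s(k := r')) + r *\<^sub>R k"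
      by (rule euclidean_eqI) (use k in \<open>simp add: inner_add_left inner_Basis\<close>)
    ultimately have upper: "cbox 0 ?V \<inter> {x. x \<bullet> k \<ge> r} = cbox (0 + r *\<^sub>R k) (V (s(k := r')) + r *\<^sub>R k)"
      by (simp only: interval_split[OF k])
    show ?thesis
      using Basis_imp[OF k, of 0 ?V r] unfolding lower upper trans by (simp add: F_def)
  qed
  have scale: "F (s(k := r)) = r * F (s(k := 1))" if "k \<in> Basis" "0 \<le> r" for s k r
    by (rule additive_nonneg_imp_linear[of "\<lambda>r. F (s(k := r))"])
      (use that split nonneg in \<open>auto simp: F_def\<close>)
  \<comment> \<open>Sides outside \<open>A\<close> are set to 1: the induction starts at the unit
    cube and reaches the full box for \<open>A = Basis\<close>.\<close>
  have F: "F (\<lambda>i. if i \<in> A then s i else 1) = prod s A * F (\<lambda>_. 1)"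
    if "finite A" "A \<subseteq> Basis" "\<And>i. i \<in> A \<Longrightarrow> 0 \<le> s i" for A s
    using that
  proof (induction A)
    case (insert k A)
    let ?s = "\<lambda>i. if i \<in> A then s i else 1"
    have "F (\<lambda>i. if i \<in> insert k A then s i else 1) = F (?s(k := s k))"
      by (rule arg_cong[of _ _ F]) auto
    also have "\<dots> = s k * F (?s(k := 1))"
      using insert.prems by (intro scale) auto
    also have "?s(k := 1) = ?s"
      using insert.hyps by auto
    finally show ?case
      using insert by simp
  qed simp
  show ?thesis
  proof (cases "\<forall>i\<in>Basis. a \<bullet> i \<le> b \<bullet> i")
    case True
    let ?s = "\<lambda>i. (b - a) \<bullet> i"
    have V_restrict: "V (\<lambda>i. if i \<in> Basis then s i else 1) = V s" for s
      unfolding V_def by (rule sum.cong) auto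
    have "G (cbox a b) = G (cbox (0 + a) ((b - a) + a))"
      by simp
    also have "\<dots> = F ?s"
      unfolding trans by (simp add: F_def V_def euclidean_representation)
    also have "\<dots> = F (\<lambda>i. if i \<in> Basis then ?s i else 1)"
      by (simp add: F_def V_restrict)
    also have "\<dots> = prod ?s Basis * F (\<lambda>_. 1)"
      using True by (intro F) (auto simp: inner_diff_left)
    also have "F (\<lambda>_. 1) = G (cbox 0 One)"
      by (simp add: F_def V_def)
    also have "prod ?s Basis = measure lborel (cbox a b)"
      using True by (simp add: content_cbox inner_diff_left)
    finally show ?thesis .
  next
    case False
    then have "box a b = {}" "cbox a b = {}"
      by (auto simp: box_eq_empty not_le intro: less_imp_le)
    then show ?thesis
      using box_empty_imp[of a b] by simp
  qed
qed

subsection \<open>Integration of radial functions\<close>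

text \<open>The density is the derivative of \<open>c * t ^ n\<close>, and \<open>0 < n\<close>
  removes the boundary term at 0. For \<open>c\<close> the volume of the unit ball, the value is the
  volume of the ball of radius \<open>t\<close>.\<close>

lemma emeasure_polar_density_atMost:
  fixes c :: real
  assumes "0 < n" "0 \<le> c"
  shows "emeasure (density lborel (\<lambda>t. ennreal (indicator {0..} t * (c * n * t ^ (n - 1))))) {..t}
    = ennreal (if 0 \<le> t then c * t ^ n else 0)"
proof -
  have "emeasure (density lborel (\<lambda>t. ennreal (indicator {0..} t * (c * n * t ^ (n - 1))))) {..t}
      = (\<integral>\<^sup>+s. ennreal (c * n * s ^ (n - 1)) * indicator {0..t} s \<partial>lborel)"
    by (subst emeasure_density) (auto intro!: nn_integral_cong simp: indicator_def)
  also have "\<dots> = ennreal (if 0 \<le> t then c * t ^ n else 0)"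
  proof (cases "0 \<le> t")
    case True
    have "(\<integral>\<^sup>+s. ennreal (c * n * s ^ (n - 1)) * indicator {0..t} s \<partial>lborel) = c * t ^ n - c * 0 ^ n"
      using assms True by (intro nn_integral_FTC_Icc) (auto intro!: derivative_eq_intros)
    with True assms(1) show ?thesis by (simp add: power_0_left)
  qed simp
  finally show ?thesis .
qed

text \<open>Polar coordinates for radial functions. Both measures give \<open>{..t}\<close> the
  volume of the ball of radius \<open>t\<close>; these half-lines are stable under intersection,
  generate the Borel sets and have finite measure.\<close>

lemma distr_lborel_norm:
  "distr lborel borel (norm :: 'a::euclidean_space \<Rightarrow> real) =
    density lborel (\<lambda>t. ennreal (indicator {0..} t *
      (unit_ball_vol (real DIM('a)) * DIM('a) * t ^ (DIM('a) - 1))))" (is "?M = ?N")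
proof (rule measure_eqI_generator_eq[where \<Omega> = UNIV and E = "range atMost" and A = "\<lambda>i::nat. {..real i}"])
  have M: "emeasure ?M {..t} = ennreal (if 0 \<le> t then unit_ball_vol (real DIM('a)) * t ^ DIM('a) else 0)" for t
  proof -
    have "norm -` {..t} = (cball 0 t :: 'a set)"
      by (auto simp: cball_def)
    then have "emeasure ?M {..t} = emeasure lborel (cball 0 t :: 'a set)"
      by (simp add: emeasure_distr)
    then show ?thesis
      by (cases "0 \<le> t") (simp_all add: emeasure_cball)
  qed
  show "emeasure ?M X = emeasure ?N X" if "X \<in> range atMost" for X
    using that M emeasure_polar_density_atMost[of "DIM('a)" "unit_ball_vol (real DIM('a))"] by auto
  show "emeasure ?M {..real i} \<noteq> \<infinity>" for i
    by (simp add: M)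
  show "Int_stable (range atMost :: real set set)"
    by (auto simp: Int_stable_def)
  show "sets ?M = sigma_sets UNIV (range atMost)" "sets ?N = sigma_sets UNIV (range atMost)"
    by (simp_all add: borel_eq_atMost)
  show "(\<Union>i::nat. {..real i}) = UNIV"
    using real_arch_simple by auto
qed auto

text \<open>Transport along the norm; the constant \<open>?c\<close>, the surface area of the unit
  sphere, is positive and so does not affect integrability.\<close>

lemma integrable_radial_iff:
  assumes [measurable]: "g \<in> borel_measurable borel"
  shows "integrable lborel (\<lambda>x::'a::euclidean_space. g (norm x)) \<longleftrightarrow>
    set_integrable lborel {0..} (\<lambda>t. g t * t ^ (DIM('a) - 1))"
proof -
  let ?c = "unit_ball_vol (real DIM('a)) * DIM('a)"
  let ?d = "\<lambda>t. indicator {0..} t * (?c * t ^ (DIM('a) - 1))"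
  have "integrable lborel (\<lambda>x::'a. g (norm x)) \<longleftrightarrow> integrable (distr lborel borel (norm :: 'a \<Rightarrow> real)) g"
    by (simp add: integrable_distr_eq)
  also have "\<dots> \<longleftrightarrow> integrable lborel (\<lambda>t. ?d t *\<^sub>R g t)"
    unfolding distr_lborel_norm by (rule integrable_density) (auto simp: indicator_def)
  also have "(\<lambda>t. ?d t *\<^sub>R g t) = (\<lambda>t. ?c * (indicator {0..} t *\<^sub>R (g t * t ^ (DIM('a) - 1))))"
    by (auto simp: fun_eq_iff)
  also have "integrable lborel \<dots> \<longleftrightarrow> set_integrable lborel {0..} (\<lambda>t. g t * t ^ (DIM('a) - 1))"
  proof -
    have "0 < ?c"
      by (intro mult_pos_pos unit_ball_vol_pos) auto
    then have "?c \<noteq> 0" by linarith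
    then show ?thesis
      unfolding set_integrable_def by (subst integrable_mult_left_iff) simp
  qed
  finally show ?thesis .
qed

subsection \<open>Simple monotone valuations\<close>

locale simple_monotone_valuation =
  fixes \<mu> :: "(real ^ 'n \<Rightarrow> ereal) \<Rightarrow> real"
  assumes val: "valuation \<mu>"
    and inv: "rigid_motion_invariant \<mu>"
    and decr: "decreasing_val \<mu>"
    and m_cont: "m_continuous \<mu>"
    and simple: "simple_val \<mu>"
begin

text \<open>Compare with the constant function infinity, where \<open>\<mu>\<close>
  vanishes.\<close>

lemma nonneg: "u \<in> conv_coercive \<Longrightarrow> 0 \<le> \<mu> u"
  using val decr infinity_conv_coercive by (force simp: valuation_def decreasing_val_def)

lemma antimono_on_class:
  "u \<in> conv_coercive \<Longrightarrow> v \<in> conv_coercive \<Longrightarrow> (\<And>x. v x \<le> u x) \<Longrightarrow> \<mu> u \<le> \<mu> v"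
  using decr by (simp add: decreasing_val_def)

text \<open>The form in which m-continuity is applied: with convergence at every point, no relative
  interior has to be computed.\<close>

lemma tendsto_decreasing:
  assumes "u \<in> conv_coercive" "\<And>i. U i \<in> conv_coercive"
    and "\<And>i x. U (Suc i) x \<le> U i x" "\<And>i x. u x \<le> U i x" "\<And>x. (\<lambda>i. U i x) \<longlonglongrightarrow> u x"
  shows "(\<lambda>i. \<mu> (U i)) \<longlonglongrightarrow> \<mu> u"
  using m_cont assms by (simp add: m_continuous_def)

text \<open>For the two halves of a cut box the minimum is the restriction to the whole box, while
  the maximum lives on a piece of the cutting hyperplane, where simplicity gives 0. Degenerate boxes
  also fall under simplicity.\<close>

lemma operative_restr:
  assumes "convex_fun w" "lower_semicont w"
  shows "operative (+) 0 (\<lambda>K. \<mu> (restr w K))"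
proof
  have cc: "restr w (cbox a b) \<in> conv_coercive" for a b
    using assms by (simp add: conv_coercive_restr_compact)
  show "\<mu> (restr w (cbox a b)) = 0" if "box a b = {}" for a b
  proof -
    have "interior (eff_dom (restr w (cbox a b))) \<subseteq> interior (cbox a b)"
      by (intro interior_mono) (simp add: eff_dom_restr)
    then show ?thesis
      using simple cc that by (simp add: simple_val_def)
  qed
  fix a b k :: "real^'n" and c :: real
  assume k: "k \<in> Basis"
  let ?S = "cbox a b \<inter> {x. x \<bullet> k \<le> c}" and ?T = "cbox a b \<inter> {x. x \<bullet> k \<ge> c}"
  have S: "restr w ?S \<in> conv_coercive" and T: "restr w ?T \<in> conv_coercive"
    unfolding interval_split[OF k] by (rule cc)+
  have min_eq: "(\<lambda>x. min (restr w ?S x) (restr w ?T x)) = restr w (cbox a b)"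
    by (auto simp: restr_def fun_eq_iff)
  \<comment> \<open>As a double restriction the maximum is visibly in the class, with its domain
    inside both half-spaces.\<close>
  have max_eq: "(\<lambda>x. max (restr w ?S x) (restr w ?T x)) = restr (restr w ?S) ?T"
    by (auto simp: restr_def fun_eq_iff)
  have "\<mu> (\<lambda>x. max (u x) (v x)) + \<mu> (\<lambda>x. min (u x) (v x)) = \<mu> u + \<mu> v"
    if "u \<in> conv_coercive" "v \<in> conv_coercive" "(\<lambda>x. min (u x) (v x)) \<in> conv_coercive" for u v
    using val that by (simp add: valuation_def)
  from this[OF S T] have "\<mu> (restr (restr w ?S) ?T) + \<mu> (restr w (cbox a b)) = \<mu> (restr w ?S) + \<mu> (restr w ?T)"
    by (simp only: min_eq max_eq cc)
  moreover have "\<mu> (restr (restr w ?S) ?T) = 0"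
  proof -
    have "convex ?T" "closed ?T"
      unfolding interval_split[OF k] by (simp_all add: closed_cbox)
    then have "restr (restr w ?S) ?T \<in> conv_coercive"
      by (rule conv_coercive_restr[OF S])
    moreover have "interior (eff_dom (restr (restr w ?S) ?T)) \<subseteq> interior {x. k \<bullet> x = c}"
      by (intro interior_mono) (auto simp: eff_dom_restr inner_commute)
    then have "interior (eff_dom (restr (restr w ?S) ?T)) = {}"
      using k by (simp add: interior_hyperplane nonzero_Basis)
    ultimately show ?thesis
      using simple by (simp add: simple_val_def)
  qed
  ultimately show "\<mu> (restr w (cbox a b)) = \<mu> (restr w ?S) + \<mu> (restr w ?T)"
    by simp
qed

text \<open>This is the \<open>f\<close> of the theorem; the unit cube has volume 1, so no
  normalising factor appears.\<close>

definition density_fun :: "real \<Rightarrow> real" where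
  "density_fun t = \<mu> (restr (\<lambda>_. ereal t) (cbox 0 One))"

lemma restr_const_conv_coercive: "restr (\<lambda>_. ereal t) (cbox a b) \<in> conv_coercive"
  by (intro conv_coercive_restr_compact convex_fun_ereal lower_semicont_ereal) (auto simp: convex_on_const)

lemma val_restr_const: "\<mu> (restr (\<lambda>_. ereal t) (cbox a b)) = measure lborel (cbox a b) * density_fun t"
  unfolding density_fun_def
proof (rule operative_translation_invariant[of "\<lambda>K. \<mu> (restr (\<lambda>_. ereal t) K)"])
  show "operative (+) 0 (\<lambda>K. \<mu> (restr (\<lambda>_. ereal t) K))"
    by (intro operative_restr convex_fun_ereal lower_semicont_ereal) (auto simp: convex_on_const)
  show "0 \<le> \<mu> (restr (\<lambda>_. ereal t) (cbox a b))" for a b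
    by (simp add: nonneg restr_const_conv_coercive)
  fix a b v :: "real^'n"
  let ?u = "restr (\<lambda>_. ereal t) (cbox (a + v) (b + v))"
  \<comment> \<open>Translation by \<open>v\<close> is the rigid motion with linear part
    \<open>mat 1\<close>; composing with it moves the box back by \<open>v\<close>.\<close>
  have "\<mu> (?u \<circ> (\<lambda>x. mat 1 *v x + v)) = \<mu> ?u"
    using inv restr_const_conv_coercive orthogonal_matrix_id
    unfolding rigid_motion_invariant_def by blast
  moreover have "?u \<circ> (\<lambda>x. mat 1 *v x + v) = restr (\<lambda>_. ereal t) (cbox a b)"
    by (auto simp: restr_def fun_eq_iff mem_box inner_add_left)
  ultimately show "\<mu> ?u = \<mu> (restr (\<lambda>_. ereal t) (cbox a b))"
    by simp
qed

lemma density_fun_nonneg: "0 \<le> density_fun t"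
  by (simp add: density_fun_def nonneg restr_const_conv_coercive)

lemma antimono_density_fun: "antimono density_fun"
  unfolding density_fun_def
  by (intro antimonoI antimono_on_class restr_const_conv_coercive) (auto simp: restr_def)

lemma density_fun_borel_measurable [measurable]: "density_fun \<in> borel_measurable borel"
proof -
  have "mono (\<lambda>t. - density_fun t)"
    using antimono_density_fun by (auto simp: mono_def antimono_def)
  then have "(\<lambda>t. - (- density_fun t)) \<in> borel_measurable borel"
    by (intro borel_measurable_uminus borel_measurable_mono)
  then show ?thesis by simp
qed

text \<open>m-continuity gives the limit along \<open>t + 1 / (i + 1)\<close>, and monotonicity
  extends it to all arguments tending to \<open>t\<close> from the right.\<close>

lemma continuous_at_right_density_fun: "continuous (at_right t) density_fun"
proof -
  have lim: "(\<lambda>i. density_fun (t + inverse (real (Suc i)))) \<longlonglongrightarrow> density_fun t"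
    unfolding density_fun_def
  proof (rule tendsto_decreasing)
    fix i x
    have *: "(\<lambda>i. ereal (t + inverse (real (Suc i)))) \<longlonglongrightarrow> ereal (t + 0)"
      by (intro tendsto_intros LIMSEQ_inverse_real_of_nat)
    then show "(\<lambda>i. restr (\<lambda>_. ereal (t + inverse (real (Suc i)))) (cbox 0 One) x)
        \<longlonglongrightarrow> restr (\<lambda>_. ereal t) (cbox 0 One) x"
      by (cases "x \<in> cbox 0 One") auto
    show "restr (\<lambda>_. ereal (t + inverse (real (Suc (Suc i))))) (cbox 0 One) x
        \<le> restr (\<lambda>_. ereal (t + inverse (real (Suc i)))) (cbox 0 One) x"
      by (simp add: restr_def le_imp_inverse_le)
    show "restr (\<lambda>_. ereal t) (cbox 0 One) x \<le> restr (\<lambda>_. ereal (t + inverse (real (Suc i)))) (cbox 0 One) x"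
      by (simp add: restr_def)
  qed (simp_all add: restr_const_conv_coercive)
  have "(density_fun \<longlongrightarrow> density_fun t) (at_right t)"
  proof (rule order_tendstoI)
    fix a assume "a < density_fun t"
    then have "\<forall>\<^sub>F i in sequentially. a < density_fun (t + inverse (real (Suc i)))"
      using order_tendstoD(1)[OF lim] by blast
    then obtain i where i: "a < density_fun (t + inverse (real (Suc i)))"
      by (meson eventually_False_sequentially eventually_mono)
    have "a < density_fun s" if "s < t + inverse (real (Suc i))" for s
      using antimonoD[OF antimono_density_fun less_imp_le[OF that]] i by simp
    then show "\<forall>\<^sub>F s in at_right t. a < density_fun s"
      unfolding eventually_at_right_field by (intro exI[of _ "t + inverse (real (Suc i))"]) auto
  next
    fix a assume "density_fun t < a"
    then have "density_fun s < a" if "t < s" for s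
      using antimonoD[OF antimono_density_fun less_imp_le[OF that]] by simp
    then show "\<forall>\<^sub>F s in at_right t. density_fun s < a"
      unfolding eventually_at_right_field by (intro exI[of _ "t + 1"]) auto
  qed
  then show ?thesis by (simp add: continuous_within)
qed

text \<open>Off the domain \<open>real_of_ereal\<close> returns 0 and \<open>dens u\<close> the
  meaningless value \<open>density_fun 0\<close>; integrals are therefore taken over
  \<open>eff_dom u\<close>.\<close>

abbreviation dens :: "(real ^ 'n \<Rightarrow> ereal) \<Rightarrow> real ^ 'n \<Rightarrow> real" where
  "dens u x \<equiv> density_fun (real_of_ereal (u x))"

section \<open>The integral formula on a box\<close>

lemma dens_borel_measurable:
  assumes "lower_semicont u"
  shows "dens u \<in> borel_measurable borel"
  using lower_semicont_borel_measurable[OF assms] by simp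

text \<open>A lower bound \<open>c\<close> of \<open>u\<close> on the box bounds the integrand by
  \<open>density_fun c\<close> on a set of finite measure.\<close>

lemma set_integrable_cbox:
  assumes u: "convex_fun u" "lower_semicont u"
  shows "set_integrable lborel (cbox a b \<inter> eff_dom u) (dens u)"
proof -
  obtain c where c: "\<And>x. x \<in> cbox a b \<Longrightarrow> ereal c \<le> u x"
    using lower_semicont_bounded_below[OF u(2), of "cbox a b"] u(1) by (auto simp: convex_fun_def)
  have bound: "norm (dens u x) \<le> density_fun c" if "x \<in> cbox a b \<inter> eff_dom u" for x
  proof -
    have "ereal c \<le> ereal (real_of_ereal (u x))"
      using that c ereal_real_eff_dom[OF u(1)] by auto
    then show ?thesis
      using antimonoD[OF antimono_density_fun] density_fun_nonneg by simp
  qed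
  have "emeasure lborel (cbox a b \<inter> eff_dom u) \<le> emeasure lborel (cbox a b)"
    by (intro emeasure_mono) auto
  also have "\<dots> < \<infinity>"
    using emeasure_lborel_cbox_finite by (simp add: less_top)
  finally show ?thesis
    unfolding set_integrable_def using bound dens_borel_measurable[OF u(2)] eff_dom_borel[OF u(2)]
    by (intro integrableI_bounded_set_indicator) auto
qed

text \<open>The frontier of a convex set is negligible, so \<open>h\<close> is free there; the upper
  and the lower estimate choose its values differently.\<close>

lemma has_integral_dens:
  assumes u: "convex_fun u" "lower_semicont u"
    and inside: "\<And>x. x \<in> interior (eff_dom u) \<Longrightarrow> h x = dens u x"
    and outside: "\<And>x. x \<notin> closure (eff_dom u) \<Longrightarrow> h x = 0"
  shows "(h has_integral (LINT x:cbox a b \<inter> eff_dom u|lborel. dens u x)) (cbox a b)"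
proof (rule has_integral_spike)
  show "negligible (frontier (eff_dom u))"
    by (simp add: negligible_convex_frontier convex_eff_dom u(1))
  show "((\<lambda>x. if x \<in> eff_dom u then dens u x else 0) has_integral
      (LINT x:cbox a b \<inter> eff_dom u|lborel. dens u x)) (cbox a b)"
    unfolding has_integral_restrict_Int
    using set_borel_integral_eq_integral[OF set_integrable_cbox[OF u]]
    by (simp add: has_integral_integral Int_commute)
  fix x assume "x \<in> cbox a b - frontier (eff_dom u)"
  then have "x \<in> interior (eff_dom u) \<or> x \<notin> closure (eff_dom u)"
    by (auto simp: frontier_def)
  then show "h x = (if x \<in> eff_dom u then dens u x else 0)"
    using inside outside interior_subset closure_subset by fastforce
qed

text \<open>The shift makes up for possible left jumps of the density: near an interior point
  \<open>x\<close> continuity gives \<open>u y + d > u x\<close>, so \<open>density_fun\<close> at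
  the value \<open>u x\<close> itself is an upper bound per unit volume.\<close>

lemma restr_shift_le_integral:
  assumes u: "convex_fun u" "lower_semicont u" and "0 < d"
  shows "\<mu> (restr (\<lambda>x. u x + ereal d) (cbox a b)) \<le> (LINT x:cbox a b \<inter> eff_dom u|lborel. dens u x)"
proof -
  define D where "D = eff_dom u"
  define w where "w = (\<lambda>x. u x + ereal d)"
  have w: "convex_fun w" "lower_semicont w"
    using u by (simp_all add: w_def convex_fun_add_const lower_semicont_add_const)
  have real_u: "ereal (real_of_ereal (u x)) = u x" if "x \<in> D" for x
    using that ereal_real_eff_dom[OF u(1)] by (simp add: D_def)
  obtain c where c: "\<And>x. x \<in> cbox a b \<Longrightarrow> ereal c \<le> u x"
    using lower_semicont_bounded_below[OF u(2), of "cbox a b"] u(1) by (auto simp: convex_fun_def)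
  \<comment> \<open>On the null set \<open>frontier D\<close> any bound for \<open>\<mu> (restr w K) / vol K\<close> will do.\<close>
  define h where "h x = (if x \<in> interior D then dens u x else if x \<in> closure D then density_fun c else 0)" for x
  \<comment> \<open>Frontier tags need no small boxes, since \<open>density_fun c\<close> works on
    every subbox; tags off the closure force boxes that miss \<open>D\<close>.\<close>
  define \<gamma> where "\<gamma> x = (if x \<in> interior D
      then interior D \<inter> (\<lambda>y. real_of_ereal (u y)) -` {real_of_ereal (u x) - d <..}
      else if x \<in> closure D then UNIV else - closure D)" for x
  have "gauge \<gamma>"
    unfolding gauge_def
  proof (intro allI conjI)
    fix x
    show "x \<in> \<gamma> x"
      using \<open>0 < d\<close> by (simp add: \<gamma>_def)
    have "open (interior D \<inter> (\<lambda>y. real_of_ereal (u y)) -` {real_of_ereal (u x) - d <..})"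
      using continuous_on_interior_eff_dom[OF u(1)]
      by (intro continuous_open_preimage) (auto simp: D_def)
    then show "open (\<gamma> x)"
      by (simp add: \<gamma>_def open_Compl)
  qed
  have "\<mu> (restr w (cbox a b)) \<le> (LINT x:cbox a b \<inter> D|lborel. dens u x)"
  proof (rule operative_le_integral[of "\<lambda>K. \<mu> (restr w K)"])
    show "operative (+) 0 (\<lambda>K. \<mu> (restr w K))"
      by (rule operative_restr[OF w])
    show "(h has_integral (LINT x:cbox a b \<inter> D|lborel. dens u x)) (cbox a b)"
      unfolding D_def using interior_subset closure_subset
      by (intro has_integral_dens u) (auto simp: h_def D_def)
    show "gauge \<gamma>" by fact
    fix x p q
    assume x: "x \<in> cbox p q" "cbox p q \<subseteq> cbox a b" "cbox p q \<subseteq> \<gamma> x"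
    let ?K = "cbox p q"
    \<comment> \<open>Each of the three cases compares \<open>w\<close> with a constant or with
      infinity; this serves the first two.\<close>
    have const: "\<mu> (restr w ?K) \<le> measure lborel ?K * density_fun t" if "\<And>y. y \<in> ?K \<Longrightarrow> ereal t \<le> w y" for t
      unfolding val_restr_const[symmetric] using that w
      by (intro antimono_on_class conv_coercive_restr_compact restr_const_conv_coercive) (auto simp: restr_def)
    consider "x \<in> interior D" | "x \<notin> interior D" "x \<in> closure D" | "x \<notin> closure D" by blast
    then show "\<mu> (restr w ?K) \<le> measure lborel ?K * h x"
    proof cases
      case 1
      have "ereal (real_of_ereal (u x)) \<le> w y" if "y \<in> ?K" for y
      proof -
        have "y \<in> interior D" "real_of_ereal (u x) \<le> real_of_ereal (u y) + d"
          using that x(3) 1 by (auto simp: \<gamma>_def)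
        then show ?thesis
          using real_u[of y] interior_subset by (metis plus_ereal.simps(1) ereal_less_eq(3) subsetD w_def)
      qed
      from const[OF this] 1 show ?thesis by (simp add: h_def)
    next
      case 2
      have "ereal c \<le> w y" if "y \<in> ?K" for y
      proof -
        have "ereal c \<le> u y" using that x(2) c by blast
        also have "\<dots> \<le> w y" using \<open>0 < d\<close> by (cases "u y") (auto simp: w_def)
        finally show ?thesis .
      qed
      from const[OF this] 2 show ?thesis by (simp add: h_def)
    next
      case 3
      moreover have int: "x \<notin> interior D"
        using 3 closure_subset interior_subset by blast
      ultimately have "?K \<subseteq> - closure D"
        using x(3) by (simp add: \<gamma>_def)
      then have "?K \<inter> D = {}"
        using closure_subset by blast
      then have "restr w ?K = (\<lambda>x. \<infinity>)"
        by (auto simp: restr_def w_def D_def eff_dom_def fun_eq_iff)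
      then have "\<mu> (restr w ?K) = 0"
        using val by (simp add: valuation_def)
      then show ?thesis
        using 3 int by (simp add: h_def)
    qed
  qed
  then show ?thesis by (simp add: w_def D_def)
qed

text \<open>Right continuity of the density leaves room above the value \<open>u x\<close>:
  \<open>u\<close> may rise up to the level \<open>\<sigma>\<close> on a small box while the density
  drops by at most \<open>e'\<close>. Elsewhere nonnegativity of \<open>\<mu>\<close>
  suffices.\<close>

lemma integral_le_restr:
  assumes u: "convex_fun u" "lower_semicont u"
  shows "(LINT x:cbox a b \<inter> eff_dom u|lborel. dens u x) \<le> \<mu> (restr u (cbox a b))"
proof (rule field_le_epsilon)
  fix e :: real assume "0 < e"
  define D where "D = eff_dom u"
  let ?I = "LINT x:cbox a b \<inter> D|lborel. dens u x"
  \<comment> \<open>The summand 1 keeps the denominator positive for boxes of volume 0.\<close>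
  define e' where "e' = e / (measure lborel (cbox a b) + 1)"
  have "0 < measure lborel (cbox a b) + 1"
    using measure_nonneg[of lborel "cbox a b"] by linarith
  then have e': "0 < e'" "measure lborel (cbox a b) * e' \<le> e"
    using \<open>0 < e\<close> by (simp_all add: e'_def pos_divide_le_eq distrib_left mult.commute)
  have real_u: "ereal (real_of_ereal (u x)) = u x" if "x \<in> D" for x
    using that ereal_real_eff_dom[OF u(1)] by (simp add: D_def)
  have "\<exists>s>t. density_fun t - e' \<le> density_fun s" for t
  proof -
    have "\<forall>\<^sub>F s in at_right t. density_fun t - e' < density_fun s"
      using continuous_at_right_density_fun[of t] e'(1)
      by (intro order_tendstoD) (auto simp: continuous_within)
    then obtain b where "b > t" "\<And>s. t < s \<Longrightarrow> s < b \<Longrightarrow> density_fun t - e' < density_fun s"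
      unfolding eventually_at_right_field by blast
    then show ?thesis
      by (meson dense less_imp_le)
  qed
  then obtain \<sigma> where \<sigma>: "\<And>t. t < \<sigma> t" "\<And>t. density_fun t - e' \<le> density_fun (\<sigma> t)"
    by metis
  define h where "h x = (if x \<in> interior D then dens u x else 0)" for x
  \<comment> \<open>Off the interior \<open>h\<close> is 0, so the gauge imposes nothing
    there.\<close>
  define \<gamma> where "\<gamma> x = (if x \<in> interior D
      then interior D \<inter> (\<lambda>y. real_of_ereal (u y)) -` {..<\<sigma> (real_of_ereal (u x))}
      else UNIV)" for x
  have "gauge \<gamma>"
    unfolding gauge_def
  proof (intro allI conjI)
    fix x
    show "x \<in> \<gamma> x"
      using \<sigma>(1) by (simp add: \<gamma>_def)
    have "open (interior D \<inter> (\<lambda>y. real_of_ereal (u y)) -` {..<\<sigma> (real_of_ereal (u x))})"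
      using continuous_on_interior_eff_dom[OF u(1)]
      by (intro continuous_open_preimage) (auto simp: D_def)
    then show "open (\<gamma> x)"
      by (simp add: \<gamma>_def)
  qed
  \<comment> \<open>The lower bound is an upper bound for the negated box function, with integrand
    \<open>e' - h\<close>.\<close>
  have "- \<mu> (restr u (cbox a b)) \<le> measure lborel (cbox a b) *\<^sub>R e' - ?I"
  proof (rule operative_le_integral[of "\<lambda>K. - \<mu> (restr u K)"])
    show "operative (+) 0 (\<lambda>K. - \<mu> (restr u K))"
      by (intro operative_uminus operative_restr u)
    have "(h has_integral ?I) (cbox a b)"
      unfolding D_def using interior_subset closure_subset
      by (intro has_integral_dens u) (auto simp: h_def D_def)
    then show "((\<lambda>x. e' - h x) has_integral (measure lborel (cbox a b) *\<^sub>R e' - ?I)) (cbox a b)"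
      by (intro has_integral_diff has_integral_const)
    show "gauge \<gamma>" by fact
    fix x p q
    assume x: "x \<in> cbox p q" "cbox p q \<subseteq> cbox a b" "cbox p q \<subseteq> \<gamma> x"
    let ?K = "cbox p q" and ?t = "\<sigma> (real_of_ereal (u x))"
    have K: "restr u ?K \<in> conv_coercive"
      using u by (simp add: conv_coercive_restr_compact)
    show "- \<mu> (restr u ?K) \<le> measure lborel ?K * (e' - h x)"
    proof (cases "x \<in> interior D")
      case True
      have "u y \<le> ereal ?t" if "y \<in> ?K" for y
      proof -
        have "y \<in> interior D" "real_of_ereal (u y) \<le> ?t"
          using that x(3) True by (auto simp: \<gamma>_def)
        then show ?thesis
          using real_u[of y] interior_subset by (metis ereal_less_eq(3) subsetD)
      qed
      then have "measure lborel ?K * density_fun ?t \<le> \<mu> (restr u ?K)"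
        unfolding val_restr_const[symmetric]
        by (intro antimono_on_class K restr_const_conv_coercive) (auto simp: restr_def)
      moreover have "measure lborel ?K * (h x - e') \<le> measure lborel ?K * density_fun ?t"
        using \<sigma>(2) True by (intro mult_left_mono) (auto simp: h_def)
      ultimately show ?thesis by (simp add: algebra_simps)
    next
      case False
      then have "0 \<le> measure lborel ?K * (e' - h x)"
        using e'(1) by (simp add: h_def)
      with nonneg[OF K] show ?thesis by linarith
    qed
  qed
  with e'(2) show "(LINT x:cbox a b \<inter> eff_dom u|lborel. dens u x) \<le> \<mu> (restr u (cbox a b)) + e"
    by (simp add: D_def)
qed

text \<open>The upper bound holds for each shift \<open>1 / (i + 1)\<close>, and m-continuity
  carries it to the limit.\<close>

lemma val_restr_cbox:
  assumes u: "convex_fun u" "lower_semicont u"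
  shows "\<mu> (restr u (cbox a b)) = (LINT x:cbox a b \<inter> eff_dom u|lborel. dens u x)"
proof (rule antisym)
  show "(LINT x:cbox a b \<inter> eff_dom u|lborel. dens u x) \<le> \<mu> (restr u (cbox a b))"
    by (rule integral_le_restr[OF u])
  define U where "U i = restr (\<lambda>x. u x + ereal (inverse (real (Suc i)))) (cbox a b)" for i
  have shift_mono: "r \<le> s \<Longrightarrow> u x + ereal r \<le> u x + ereal s" for r s x
    by (simp add: add_left_mono)
  have "(\<lambda>i. \<mu> (U i)) \<longlonglongrightarrow> \<mu> (restr u (cbox a b))"
  proof (rule tendsto_decreasing)
    show "restr u (cbox a b) \<in> conv_coercive" "U i \<in> conv_coercive" for i
      using u unfolding U_def
      by (simp_all add: conv_coercive_restr_compact convex_fun_add_const lower_semicont_add_const)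
    fix i x
    show "U (Suc i) x \<le> U i x"
      unfolding U_def restr_def by (auto intro!: shift_mono le_imp_inverse_le)
    show "restr u (cbox a b) x \<le> U i x"
      using shift_mono[of 0 "inverse (real (Suc i))" x] by (simp add: U_def restr_def)
    have *: "(\<lambda>i. u x + ereal (inverse (real (Suc i)))) \<longlonglongrightarrow> u x + ereal 0"
      by (intro tendsto_add_ereal_general tendsto_intros LIMSEQ_inverse_real_of_nat) auto
    then show "(\<lambda>i. U i x) \<longlonglongrightarrow> restr u (cbox a b) x"
      unfolding U_def restr_def by auto
  qed
  then show "\<mu> (restr u (cbox a b)) \<le> (LINT x:cbox a b \<inter> eff_dom u|lborel. dens u x)"
    using restr_shift_le_integral[OF u] unfolding U_def by (intro LIMSEQ_le_const2) auto
qed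

text \<open>On growing cubes m-continuity handles \<open>\<mu>\<close> and monotone convergence the
  integrals. As the integrals converge to the real number \<open>\<mu> u\<close>, integrability
  comes out along with the formula.\<close>

lemma has_bochner_integral_val:
  assumes u: "u \<in> conv_coercive"
  shows "has_bochner_integral lborel (\<lambda>x. indicator (eff_dom u) x *\<^sub>R dens u x) (\<mu> u)"
proof -
  note uc = conv_coerciveD[OF u]
  define B :: "nat \<Rightarrow> (real^'n) set" where "B i = cbox (- (real i *\<^sub>R One)) (real i *\<^sub>R One)" for i
  have B_mono: "B i \<subseteq> B j" if "i \<le> j" for i j
    unfolding B_def using that by (intro subset_box_imp) simp
  \<comment> \<open>At a fixed \<open>x\<close> both the restrictions of \<open>u\<close> and the
    truncated integrands are thus eventually constant.\<close>
  have B_ex: "\<exists>i. \<forall>j\<ge>i. x \<in> B j" for x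
  proof -
    obtain i :: nat where "norm x \<le> real i"
      using real_arch_simple by blast
    then have "x \<in> B i"
      using Basis_le_norm[of _ x] by (fastforce simp: B_def mem_box abs_le_iff)
    then show ?thesis using B_mono by blast
  qed
  define F where "F i x = indicator (B i \<inter> eff_dom u) x *\<^sub>R dens u x" for i x
  have val_B: "\<mu> (restr u (B i)) = integral\<^sup>L lborel (F i)" for i
    using val_restr_cbox[OF uc] by (simp add: F_def[abs_def] B_def set_lebesgue_integral_def)
  have "(\<lambda>i. \<mu> (restr u (B i))) \<longlonglongrightarrow> \<mu> u"
  proof (rule tendsto_decreasing)
    fix i x
    show "restr u (B i) \<in> conv_coercive"
      unfolding B_def by (intro conv_coercive_restr u) auto
    show "restr u (B (Suc i)) x \<le> restr u (B i) x"
      using B_mono[of i "Suc i"] by (auto simp: restr_def)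
    have "\<forall>\<^sub>F i in sequentially. restr u (B i) x = u x"
      using B_ex[of x] by (auto simp: eventually_sequentially restr_def)
    then show "(\<lambda>i. restr u (B i) x) \<longlonglongrightarrow> u x"
      by (rule tendsto_eventually)
  qed (auto simp: u le_restr)
  then have lim: "(\<lambda>i. integral\<^sup>L lborel (F i)) \<longlonglongrightarrow> \<mu> u"
    by (simp add: val_B)
  show ?thesis
  proof (rule has_bochner_integral_monotone_convergence[OF _ _ _ lim])
    show "integrable lborel (F i)" for i
      using set_integrable_cbox[OF uc] by (simp add: F_def[abs_def] B_def set_integrable_def)
    show "AE x in lborel. mono (\<lambda>i. F i x)"
    proof (intro AE_I2 monoI)
      fix x and i j :: nat assume "i \<le> j"
      then show "F i x \<le> F j x"
        using B_mono[of i j] density_fun_nonneg by (auto simp: F_def indicator_def)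
    qed
    show "AE x in lborel. (\<lambda>i. F i x) \<longlonglongrightarrow> indicator (eff_dom u) x *\<^sub>R dens u x"
    proof (rule AE_I2)
      fix x
      have "\<forall>\<^sub>F i in sequentially. F i x = indicator (eff_dom u) x *\<^sub>R dens u x"
        using B_ex[of x] by (auto simp: eventually_sequentially F_def indicator_def)
      then show "(\<lambda>i. F i x) \<longlonglongrightarrow> indicator (eff_dom u) x *\<^sub>R dens u x"
        by (rule tendsto_eventually)
    qed
    show "(\<lambda>x. indicator (eff_dom u) x *\<^sub>R dens u x) \<in> borel_measurable lborel"
      using eff_dom_borel[OF uc(2)] dens_borel_measurable[OF uc(2)] by simp
  qed
qed

end

theorem theorem1p3:
  fixes \<mu> :: "(real ^ 'n \<Rightarrow> ereal) \<Rightarrow> real"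
  assumes "valuation \<mu>"
    and "rigid_motion_invariant \<mu>"
    and "decreasing_val \<mu>"
    and "m_continuous \<mu>"
    and "simple_val \<mu>"
  shows "\<exists>f :: real \<Rightarrow> real. antimono f \<and> (\<forall>t. continuous (at_right t) f) \<and>
           set_integrable lborel {0..} (\<lambda>t. f t * t ^ (CARD('n) - 1)) \<and>
           (\<forall>u\<in>conv_coercive.
              set_integrable lborel (eff_dom u) (\<lambda>x. f (real_of_ereal (u x))) \<and>
              \<mu> u = (LINT x:eff_dom u|lborel. f (real_of_ereal (u x))))"
proof -
  interpret simple_monotone_valuation \<mu>
    by standard (fact assms)+
  \<comment> \<open>The domain of the norm is the whole space, so integrability of the density
    composed with the norm is the moment condition in polar coordinates.\<close>
  have "has_bochner_integral lborel (\<lambda>x::real^'n. density_fun (norm x)) (\<mu> (\<lambda>x. ereal (norm x)))"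
    using has_bochner_integral_val[OF norm_conv_coercive] by (simp add: eff_dom_def)
  then have "integrable lborel (\<lambda>x::real^'n. density_fun (norm x))"
    by (rule integrable.intros)
  then have "set_integrable lborel {0..} (\<lambda>t. density_fun t * t ^ (CARD('n) - 1))"
    by (simp add: integrable_radial_iff)
  then show ?thesis
    using antimono_density_fun continuous_at_right_density_fun has_bochner_integral_val
    by (intro exI[of _ density_fun])
      (auto simp: has_bochner_integral_iff set_integrable_def set_lebesgue_integral_def)
qed

end
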